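(* Let $\alpha$ be an irrational real number, and let $(q_k)_{k\ge0}$ be the denominators of its continued-fraction convergents. Let $\psi:(0,\infty)\to(0,\infty)$ be non-increasing and dyadically regular (i.e. there exist $\varrho\in(0,1)$ and an integer $k_0\ge0$ with $\psi(2^{k+1})\le\varrho\,\psi(2^k)$ for all $k\ge k_0$). Then \[ \sum_{j=0}^{\infty}M_\alpha(\psi(2^j),2^j)<\infty \quad\Longleftrightarrow\quad \sum_{k=0}^{\infty}\ \sum_{q=q_k}^{q_{k+1}-1}\min\{\psi(q),|q_k\alpha|_{\mathbb Z}\}<\infty. \]
   Context: $|x|_{\mathbb Z}:=\min_{p\in\mathbb Z}|x-p|$ for $x\in\mathbb R$. The convergent denominators start with $q_0=1$; an inner sum with $q_{k+1}-1<q_k$ is empty. For $r,T>0$, \[ N_\alpha(r,T):=\#\{(p,q)\in\mathbb Z\times\mathbb Z: |\alpha q-p|\le r,\ |q|\le T\},\qquad M_\alpha(r,T):=\frac{rT}{N_\alpha(r,T)}. \] *)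

theory Defs
  imports "HOL-Analysis.Analysis"
begin

definition dist_int :: "real \<Rightarrow> real" where
  "dist_int x = (LEAST d. \<exists>p::int. d = \<bar>x - of_int p\<bar>)"

lemma dist_int_is_minimum:
  "\<exists>p::int. dist_int x = \<bar>x - of_int p\<bar> \<and> (\<forall>p'::int. \<bar>x - of_int p\<bar> \<le> \<bar>x - of_int p'\<bar>)"
proof -
  have min: "\<bar>x - of_int (round x)\<bar> \<le> \<bar>x - of_int p'\<bar>" for p' :: int
    using round_diff_minimal[of x p'] by simp
  have "dist_int x = \<bar>x - of_int (round x)\<bar>"
    unfolding dist_int_def by (rule Least_equality) (use min in auto)
  with min show ?thesis by blast
qed


text \<open>
  The convergents of a continued fraction \<open>[a 0; a 1, a 2, \<dots>]\<close> are given by the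
  usual recursions. Lemma \<open>cf_value_eq\<close> and its companions show that
  \<open>cf_num a k / cf_den a k\<close> is the value of \<open>[a 0; a 1, \<dots>, a k]\<close> in lowest terms.
\<close>

fun cf_num :: "(nat \<Rightarrow> int) \<Rightarrow> nat \<Rightarrow> int" where
  "cf_num a 0 = a 0"
| "cf_num a (Suc 0) = a 1 * a 0 + 1"
| "cf_num a (Suc (Suc k)) = a (Suc (Suc k)) * cf_num a (Suc k) + cf_num a k"

fun cf_den :: "(nat \<Rightarrow> int) \<Rightarrow> nat \<Rightarrow> int" where
  "cf_den a 0 = 1"
| "cf_den a (Suc 0) = a 1"
| "cf_den a (Suc (Suc k)) = a (Suc (Suc k)) * cf_den a (Suc k) + cf_den a k"

fun cf_value :: "(nat \<Rightarrow> int) \<Rightarrow> nat \<Rightarrow> real" where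
  "cf_value a 0 = of_int (a 0)"
| "cf_value a (Suc k) = of_int (a 0) + 1 / cf_value (\<lambda>i. a (Suc i)) k"

lemma cf_shift:
  "cf_num a (Suc k) = a 0 * cf_num (\<lambda>i. a (Suc i)) k + cf_den (\<lambda>i. a (Suc i)) k
   \<and> cf_den a (Suc k) = cf_num (\<lambda>i. a (Suc i)) k"
  by (induction k rule: cf_den.induct[of "\<lambda>_ k. P k" a for P]) (auto simp: algebra_simps)

lemma cf_pos:
  assumes "\<And>i. i \<ge> 1 \<Longrightarrow> a i > 0"
  shows "cf_den a k > 0"
  using assms by (induction a k rule: cf_den.induct) (auto intro!: add_pos_pos)

lemma cf_num_pos:
  assumes "\<And>i. a i > 0"
  shows "cf_num a k > 0"
  using assms by (induction a k rule: cf_num.induct)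
    (auto intro!: add_pos_pos add_nonneg_pos mult_nonneg_nonneg simp: less_imp_le)

lemma cf_value_eq:
  assumes "\<And>i. i \<ge> 1 \<Longrightarrow> a i > 0"
  shows "cf_value a k = of_int (cf_num a k) / of_int (cf_den a k)"
  using assms
proof (induction k arbitrary: a)
  case 0
  then show ?case by simp
next
  case (Suc k)
  let ?b = "\<lambda>i. a (Suc i)"
  have "cf_num ?b k > 0" using Suc.prems by (intro cf_num_pos) simp
  moreover have "cf_value ?b k = of_int (cf_num ?b k) / of_int (cf_den ?b k)"
    using Suc.prems by (intro Suc.IH) simp
  ultimately show ?case using cf_shift[of a k] by (simp add: field_simps)
qed

lemma cf_coprime: "coprime (cf_num a k) (cf_den a k)"
proof (induction k arbitrary: a)
  case 0
  then show ?case by simp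
next
  case (Suc k)
  let ?b = "\<lambda>i. a (Suc i)"
  have "gcd (cf_den ?b k + a 0 * cf_num ?b k) (cf_num ?b k) = 1"
    using Suc.IH[of ?b] by (metis coprime_iff_gcd_eq_1 gcd.commute gcd_add_mult mult.commute add.commute)
  then show ?case using cf_shift[of a k] by (simp add: coprime_iff_gcd_eq_1 add.commute)
qed


fun complete_quotient :: "real \<Rightarrow> nat \<Rightarrow> real" where
  "complete_quotient \<alpha> 0 = \<alpha>"
| "complete_quotient \<alpha> (Suc k) = 1 / frac (complete_quotient \<alpha> k)"

definition partial_quotient :: "real \<Rightarrow> nat \<Rightarrow> int" where
  "partial_quotient \<alpha> k = \<lfloor>complete_quotient \<alpha> k\<rfloor>"

definition convergent_denom :: "real \<Rightarrow> nat \<Rightarrow> int" where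
  "convergent_denom \<alpha> = cf_den (partial_quotient \<alpha>)"

lemma complete_quotient_irrational:
  assumes "\<alpha> \<notin> \<rat>"
  shows "complete_quotient \<alpha> k \<notin> \<rat>"
proof (induction k)
  case (Suc k)
  show ?case
  proof
    assume "complete_quotient \<alpha> (Suc k) \<in> \<rat>"
    then have "inverse (complete_quotient \<alpha> (Suc k)) \<in> \<rat>"
      by (rule Rats_inverse)
    then have "frac (complete_quotient \<alpha> k) \<in> \<rat>"
      by simp
    then have "frac (complete_quotient \<alpha> k) + of_int \<lfloor>complete_quotient \<alpha> k\<rfloor> \<in> \<rat>"
      by (intro Rats_add) auto
    then show False using Suc by (simp add: frac_def)
  qed
qed (use assms in simp)

lemma partial_quotient_pos:
  assumes "\<alpha> \<notin> \<rat>" "k \<ge> 1"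
  shows "partial_quotient \<alpha> k > 0"
proof -
  obtain j where k: "k = Suc j" using assms(2) by (cases k) auto
  let ?x = "complete_quotient \<alpha> j"
  have "?x \<notin> \<int>"
    using complete_quotient_irrational[OF assms(1), of j] Ints_subset_Rats by blast
  then have "frac ?x > 0" "frac ?x < 1" by (simp_all add: frac_lt_1)
  then show ?thesis by (simp add: k partial_quotient_def field_simps)
qed


definition approx_points :: "real \<Rightarrow> real \<Rightarrow> real \<Rightarrow> (int \<times> int) set" where
  "approx_points \<alpha> r T =
     {(p, q). \<bar>\<alpha> * of_int q - of_int p\<bar> \<le> r \<and> \<bar>of_int q\<bar> \<le> T}"

definition N_count :: "real \<Rightarrow> real \<Rightarrow> real \<Rightarrow> nat" where
  "N_count \<alpha> r T = card (approx_points \<alpha> r T)"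

definition M_ratio :: "real \<Rightarrow> real \<Rightarrow> real \<Rightarrow> real" where
  "M_ratio \<alpha> r T = r * T / real (N_count \<alpha> r T)"

lemma finite_approx_points: "finite (approx_points \<alpha> r T)"
proof (rule finite_subset)
  let ?B = "\<lceil>\<bar>\<alpha>\<bar> * \<bar>T\<bar> + \<bar>r\<bar>\<rceil>"
  show "approx_points \<alpha> r T \<subseteq> {-?B..?B} \<times> {-\<lceil>T\<rceil>..\<lceil>T\<rceil>}"
  proof
    fix z assume "z \<in> approx_points \<alpha> r T"
    then obtain p q where z: "z = (p, q)"
      and p: "\<bar>\<alpha> * of_int q - of_int p\<bar> \<le> r" and q: "\<bar>real_of_int q\<bar> \<le> T"
      by (auto simp: approx_points_def)
    have "\<bar>\<alpha> * of_int q\<bar> \<le> \<bar>\<alpha>\<bar> * \<bar>T\<bar>"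
      using q by (simp add: abs_mult mult_left_mono)
    then have "\<bar>real_of_int p\<bar> \<le> \<bar>\<alpha>\<bar> * \<bar>T\<bar> + \<bar>r\<bar>" using p by linarith
    then have "\<bar>p\<bar> \<le> ?B" by linarith
    moreover have "\<bar>q\<bar> \<le> \<lceil>T\<rceil>" using q by linarith
    ultimately show "z \<in> {-?B..?B} \<times> {-\<lceil>T\<rceil>..\<lceil>T\<rceil>}" by (auto simp: z)
  qed
qed simp

lemma N_count_pos:
  assumes "r > 0" "T > 0"
  shows "N_count \<alpha> r T > 0"
proof -
  have "(0, 0) \<in> approx_points \<alpha> r T" using assms by (simp add: approx_points_def)
  then show ?thesis
    unfolding N_count_def using finite_approx_points by (metis card_gt_0_iff empty_iff)
qed


definition dyadically_regular :: "(real \<Rightarrow> real) \<Rightarrow> bool" where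
  "dyadically_regular \<psi> \<longleftrightarrow>
     (\<exists>\<rho>::real. 0 < \<rho> \<and> \<rho> < 1 \<and> (\<exists>k0::nat. \<forall>k\<ge>k0. \<psi> (2 ^ (k + 1)) \<le> \<rho> * \<psi> (2 ^ k)))"

end

theory Submission
  imports Defs
begin

text \<open>
  Let \<open>D\<^sub>k = \<bar>q\<^sub>k \<alpha> - p\<^sub>k\<bar>\<close>, let \<open>\<kappa>(n)\<close> be the index with \<open>q\<^sub>\<kappa> \<le> n < q\<^sub>\<kappa>\<^sub>+\<^sub>1\<close>, and let
  \<open>f(n) = min (\<psi> n) D\<^sub>\<kappa>\<^sub>(\<^sub>n\<^sub>)\<close>. The double sum is the sum of the non-increasing \<open>f\<close>, so by Cauchy
  condensation it converges iff \<open>\<Sum> g\<^sub>j\<close> does, where \<open>g\<^sub>j = 2\<^sup>j f(2\<^sup>j)\<close>.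
  Write \<open>T = 2\<^sup>j\<close>, \<open>r = \<psi>(T)\<close>, \<open>k = \<kappa>(T)\<close>. By best approximation the values \<open>q\<alpha> - p\<close> with \<open>0 \<le> q \<le> T\<close>
  are \<open>D\<^sub>k\<close>-separated, so \<open>N \<le> 4r/D\<^sub>k + 2\<close> and \<open>M \<ge> g\<^sub>j/6\<close>. Counting multiples of \<open>(p\<^sub>k, q\<^sub>k)\<close>
  gives \<open>M \<le> g\<^sub>j + e\<^sub>j\<close> with \<open>e\<^sub>j = r q\<^sub>k\<close>.
  If \<open>\<Sum> g\<^sub>j\<close> converges then eventually \<open>e\<^sub>j\<^sub>+\<^sub>1 \<le> \<rho> e\<^sub>j + 2 g\<^sub>j\<close>, so \<open>\<Sum> e\<^sub>j\<close> converges: if \<open>\<kappa>\<close> does not change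
  from \<open>2\<^sup>j\<close> to \<open>2\<^sup>j\<^sup>+\<^sup>1\<close> this is dyadic regularity; otherwise \<open>q\<^sub>k\<^sub>+\<^sub>1 \<le> 2T\<close>, so \<open>T D\<^sub>k \<ge> 1/4\<close>, and
  \<open>g\<^sub>j < 1/4\<close> forces \<open>g\<^sub>j = T \<psi>(T)\<close>.
\<close>

section \<open>Convergents: growth of denominators, alternating errors, best approximation\<close>

definition convergent_num :: "real \<Rightarrow> nat \<Rightarrow> int" where
  "convergent_num \<alpha> = cf_num (partial_quotient \<alpha>)"

definition convergent_diff :: "real \<Rightarrow> nat \<Rightarrow> real" where
  "convergent_diff \<alpha> k = of_int (convergent_denom \<alpha> k) * \<alpha> - of_int (convergent_num \<alpha> k)"

lemma frac_complete_quotient: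
  assumes "\<alpha> \<notin> \<rat>"
  shows "0 < frac (complete_quotient \<alpha> k)" "frac (complete_quotient \<alpha> k) < 1"
proof -
  have "complete_quotient \<alpha> k \<notin> \<int>"
    using complete_quotient_irrational[OF assms, of k] Ints_subset_Rats by blast
  then show "0 < frac (complete_quotient \<alpha> k)" by simp
qed (rule frac_lt_1)

lemma convergent_denom_0 [simp]: "convergent_denom \<alpha> 0 = 1"
  by (simp add: convergent_denom_def)

lemma convergent_denom_pos:
  assumes "\<alpha> \<notin> \<rat>"
  shows "convergent_denom \<alpha> k > 0"
  unfolding convergent_denom_def by (intro cf_pos partial_quotient_pos[OF assms])

lemma convergent_denom_Suc_Suc_ge:
  assumes "\<alpha> \<notin> \<rat>"
  shows "convergent_denom \<alpha> (Suc (Suc k)) \<ge> convergent_denom \<alpha> (Suc k) + convergent_denom \<alpha> k"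
proof -
  have "1 * convergent_denom \<alpha> (Suc k)
      \<le> partial_quotient \<alpha> (Suc (Suc k)) * convergent_denom \<alpha> (Suc k)"
    using partial_quotient_pos[OF assms, of "Suc (Suc k)"] convergent_denom_pos[OF assms, of "Suc k"]
    by (intro mult_right_mono) auto
  then show ?thesis by (simp add: convergent_denom_def)
qed

lemma mono_convergent_denom:
  assumes "\<alpha> \<notin> \<rat>"
  shows "mono (convergent_denom \<alpha>)"
  unfolding mono_iff_le_Suc
proof
  fix k
  show "convergent_denom \<alpha> k \<le> convergent_denom \<alpha> (Suc k)"
  proof (cases k)
    case 0
    then show ?thesis using convergent_denom_pos[OF assms, of 1] by simp
  next
    case (Suc m)
    then show ?thesis
      using convergent_denom_Suc_Suc_ge[OF assms, of m] convergent_denom_pos[OF assms, of m] by simp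
  qed
qed

text \<open>Since a_1 may be 1, q_0 = q_1 is possible and strict growth starts only at index 1; a
  two-step induction absorbs this. The bound makes the denominators unbounded, so every n lies below
  some q_(k+1).\<close>

lemma convergent_denom_ge:
  assumes "\<alpha> \<notin> \<rat>"
  shows "int k \<le> convergent_denom \<alpha> k"
proof (induction k rule: induct_nat_012)
  case 1
  then show ?case using convergent_denom_pos[OF assms, of 1] by simp
next
  case (ge2 k)
  then show ?case
    using convergent_denom_Suc_Suc_ge[OF assms, of k] convergent_denom_pos[OF assms, of k] by simp
qed simp

text \<open>If t is minus the ratio of two consecutive errors, the recursion turns it into 1/t -
  floor(1/t), which is also how the fractional parts of the complete quotients evolve. The sign
  makes errors alternate, and the factor below 1 makes them shrink.\<close>

lemma convergent_diff_Suc: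
  assumes "\<alpha> \<notin> \<rat>"
  shows "convergent_diff \<alpha> (Suc k) = - convergent_diff \<alpha> k * frac (complete_quotient \<alpha> (Suc k))"
proof (induction k)
  case 0
  have "frac \<alpha> > 0" using frac_complete_quotient(1)[OF assms, of 0] by simp
  then show ?case
    by (simp add: convergent_diff_def convergent_denom_def convergent_num_def
        partial_quotient_def frac_def field_simps)
next
  case (Suc k)
  define t where "t = frac (complete_quotient \<alpha> (Suc k))"
  have "t > 0" unfolding t_def by (rule frac_complete_quotient(1)[OF assms])
  have q: "complete_quotient \<alpha> (Suc (Suc k)) = 1 / t" by (simp add: t_def)
  have "convergent_diff \<alpha> (Suc (Suc k)) =
      of_int \<lfloor>1 / t\<rfloor> * convergent_diff \<alpha> (Suc k) + convergent_diff \<alpha> k"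
    by (simp add: convergent_diff_def convergent_denom_def convergent_num_def
        partial_quotient_def algebra_simps t_def)
  also have "convergent_diff \<alpha> k = - convergent_diff \<alpha> (Suc k) / t"
    using Suc \<open>t > 0\<close> by (simp add: t_def field_simps)
  finally show ?case unfolding q by (simp add: frac_def algebra_simps)
qed

lemma convergent_diff_nonzero:
  assumes "\<alpha> \<notin> \<rat>"
  shows "convergent_diff \<alpha> k \<noteq> 0"
proof (induction k)
  case 0
  then show ?case
    using frac_complete_quotient(1)[OF assms, of 0]
    by (simp add: convergent_diff_def convergent_denom_def convergent_num_def
        partial_quotient_def frac_def)
next
  case (Suc k)
  then show ?case
    using frac_complete_quotient(1)[OF assms, of "Suc k"] convergent_diff_Suc[OF assms, of k] by simp
qed

lemma antimono_abs_convergent_diff: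
  assumes "\<alpha> \<notin> \<rat>"
  shows "antimono (\<lambda>k. \<bar>convergent_diff \<alpha> k\<bar>)"
  unfolding antimono_iff_le_Suc
proof
  fix k
  show "\<bar>convergent_diff \<alpha> (Suc k)\<bar> \<le> \<bar>convergent_diff \<alpha> k\<bar>"
    using frac_complete_quotient[OF assms, of "Suc k"]
    unfolding convergent_diff_Suc[OF assms] abs_mult abs_minus_cancel
    by (intro mult_left_le) auto
qed

lemma convergent_det:
  "convergent_num \<alpha> (Suc k) * convergent_denom \<alpha> k - convergent_num \<alpha> k * convergent_denom \<alpha> (Suc k)
    = (-1) ^ k"
proof (induction k)
  case 0
  then show ?case by (simp add: convergent_denom_def convergent_num_def)
next
  case (Suc k)
  have "convergent_num \<alpha> (Suc (Suc k)) * convergent_denom \<alpha> (Suc k)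
      - convergent_num \<alpha> (Suc k) * convergent_denom \<alpha> (Suc (Suc k))
    = - (convergent_num \<alpha> (Suc k) * convergent_denom \<alpha> k
      - convergent_num \<alpha> k * convergent_denom \<alpha> (Suc k))"
    by (simp add: convergent_denom_def convergent_num_def algebra_simps)
  then show ?case unfolding Suc by simp
qed

text \<open>Eliminating alpha from two consecutive errors leaves the determinant, so 1 <= q_(k+1)
  D_k + q_k D_(k+1); monotonicity bounds the right side by 2 q_(k+1) D_k.\<close>

lemma abs_convergent_diff_ge:
  assumes "\<alpha> \<notin> \<rat>"
  shows "1 / (2 * of_int (convergent_denom \<alpha> (Suc k))) \<le> \<bar>convergent_diff \<alpha> k\<bar>"
proof -
  let ?q = "\<lambda>k. real_of_int (convergent_denom \<alpha> k)"
  let ?d = "convergent_diff \<alpha>"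
  have q: "0 < ?q k" "?q k \<le> ?q (Suc k)"
    using convergent_denom_pos[OF assms, of k] mono_convergent_denom[OF assms]
    by (auto simp: mono_iff_le_Suc)
  have d: "\<bar>?d (Suc k)\<bar> \<le> \<bar>?d k\<bar>"
    using antimono_abs_convergent_diff[OF assms] by (auto simp: antimono_iff_le_Suc)
  have "?q (Suc k) * ?d k - ?q k * ?d (Suc k) = of_int ((-1) ^ k)"
    unfolding convergent_det[of \<alpha> k, symmetric] by (simp add: convergent_diff_def algebra_simps)
  then have "1 = \<bar>?q (Suc k) * ?d k - ?q k * ?d (Suc k)\<bar>" by simp
  also have "\<dots> \<le> \<bar>?q (Suc k) * ?d k\<bar> + \<bar>?q k * ?d (Suc k)\<bar>" by (rule abs_triangle_ineq4)
  also have "\<dots> = ?q (Suc k) * \<bar>?d k\<bar> + ?q k * \<bar>?d (Suc k)\<bar>" using q by (simp add: abs_mult)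
  also have "\<dots> \<le> ?q (Suc k) * \<bar>?d k\<bar> + ?q (Suc k) * \<bar>?d k\<bar>"
    using q d by (intro add_left_mono mult_mono) auto
  finally show ?thesis using q by (simp add: field_simps)
qed

text \<open>
  Consecutive convergents form a basis of the integer lattice, and a point with \<open>\<bar>q\<bar> < q\<^sub>k\<^sub>+\<^sub>1\<close> has
  coordinates of opposite sign, which do not cancel because the differences alternate in sign.
\<close>
lemma convergent_best_approximation:
  fixes p q :: int
  assumes "\<alpha> \<notin> \<rat>" "\<bar>q\<bar> < convergent_denom \<alpha> (Suc k)" "(p, q) \<noteq> (0, 0)"
  shows "\<bar>convergent_diff \<alpha> k\<bar> \<le> \<bar>\<alpha> * of_int q - of_int p\<bar>"
proof -
  define p0 q0 p1 q1 where "p0 = convergent_num \<alpha> k" and "q0 = convergent_denom \<alpha> k"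
    and "p1 = convergent_num \<alpha> (Suc k)" and "q1 = convergent_denom \<alpha> (Suc k)"
  note defs = p0_def q0_def p1_def q1_def
  \<comment> \<open>The determinant \<open>s\<close> is its own inverse, so Cramer's rule yields
    integer coordinates \<open>u\<close>, \<open>v\<close> of (p, q) in the basis of consecutive
    convergents.\<close>
  define s :: int where "s = (-1) ^ k"
  define u v where "u = s * (q * p1 - p * q1)" and "v = s * (p * q0 - q * p0)"
  have det: "p1 * q0 - p0 * q1 = s" using convergent_det[of \<alpha> k] by (simp add: defs s_def)
  have ss: "s * s = 1" by (simp add: s_def flip: power_add)
  have "u * p0 + v * p1 = s * (p1 * q0 - p0 * q1) * p" by (simp add: u_def v_def algebra_simps)
  then have p: "p = u * p0 + v * p1" by (simp add: det ss)
  have "u * q0 + v * q1 = s * (p1 * q0 - p0 * q1) * q" by (simp add: u_def v_def algebra_simps)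
  then have q: "q = u * q0 + v * q1" by (simp add: det ss)
  have pos: "q0 > 0" "q1 > 0" using convergent_denom_pos[OF assms(1)] by (simp_all add: defs)
  have small: "\<bar>u * q0 + v * q1\<bar> < q1" using assms(2) by (simp add: q defs)
  have v1: "v * q1 \<ge> q1" if "v > 0" using that pos by simp
  have v2: "v * q1 \<le> - q1" if "v < 0"
    using that pos mult_right_mono[of v "-1" q1] by simp
  have u: "v > 0 \<Longrightarrow> u * q0 < 0" "v < 0 \<Longrightarrow> u * q0 > 0"
    using v1 v2 small by linarith+
  have "u \<noteq> 0" using assms(3) u by (cases v "0 :: int" rule: linorder_cases) (auto simp: p q)
  define t where "t = frac (complete_quotient \<alpha> (Suc k))"
  have t: "t > 0" unfolding t_def by (rule frac_complete_quotient(1)[OF assms(1)])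
  \<comment> \<open>This is the error of (p, q) relative to D_k. As t > 0, opposite signs of
    \<open>u\<close> and \<open>v\<close> make the two terms reinforce each other.\<close>
  have "1 \<le> \<bar>of_int u - of_int v * t\<bar>"
  proof (cases v "0 :: int" rule: linorder_cases)
    case less
    then have "u > 0" using u pos by (simp add: zero_less_mult_iff)
    moreover have "of_int v * t < 0" using less t by (simp add: mult_less_0_iff)
    ultimately show ?thesis by linarith
  next
    case equal
    then show ?thesis using \<open>u \<noteq> 0\<close> by simp
  next
    case greater
    then have "u < 0" using u pos by (simp add: mult_less_0_iff)
    moreover have "of_int v * t > 0" using greater t by simp
    ultimately show ?thesis by linarith
  qed
  then have "\<bar>convergent_diff \<alpha> k\<bar> * 1 \<le> \<bar>convergent_diff \<alpha> k\<bar> * \<bar>of_int u - of_int v * t\<bar>"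
    by (intro mult_left_mono) auto
  also have "\<dots> = \<bar>of_int u * convergent_diff \<alpha> k + of_int v * convergent_diff \<alpha> (Suc k)\<bar>"
    unfolding convergent_diff_Suc[OF assms(1)] t_def[symmetric] abs_mult[symmetric]
    by (simp add: algebra_simps)
  also have "\<dots> = \<bar>\<alpha> * of_int q - of_int p\<bar>"
    by (simp add: p q convergent_diff_def defs algebra_simps)
  finally show ?thesis by simp
qed

text \<open>Best approximation applies to q_k itself only if q_k < q_(k+1). In the excluded case q_0
  = q_1 = 1 the fractional part of alpha exceeds 1/2, so D_0 is not the distance; there the inner
  sum is empty.\<close>

lemma dist_int_convergent:
  assumes "\<alpha> \<notin> \<rat>" "convergent_denom \<alpha> k < convergent_denom \<alpha> (Suc k)"
  shows "dist_int (of_int (convergent_denom \<alpha> k) * \<alpha>) = \<bar>convergent_diff \<alpha> k\<bar>"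
proof -
  let ?x = "of_int (convergent_denom \<alpha> k) * \<alpha>"
  obtain p :: int where p: "dist_int ?x = \<bar>?x - of_int p\<bar>" "\<And>p' :: int. \<bar>?x - of_int p\<bar> \<le> \<bar>?x - of_int p'\<bar>"
    using dist_int_is_minimum by blast
  have "\<bar>convergent_diff \<alpha> k\<bar> \<le> \<bar>?x - of_int p\<bar>"
    using convergent_best_approximation[OF assms(1), of "convergent_denom \<alpha> k" k p]
      assms(2) convergent_denom_pos[OF assms(1), of k] by (simp add: mult.commute)
  then show ?thesis using p(1) p(2)[of "convergent_num \<alpha> k"] by (simp add: convergent_diff_def)
qed

section \<open>Two-sided bounds for the lattice point count\<close>

text \<open>Pigeonhole: cut [-r, r] into half-open cells of length \<open>\<delta>\<close>; each
  holds at most one value.\<close>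

lemma card_separated_le:
  fixes h :: "'a \<Rightarrow> real"
  assumes "finite S" "\<delta> > 0" "r \<ge> 0"
    and "\<And>x. x \<in> S \<Longrightarrow> \<bar>h x\<bar> \<le> r"
    and "\<And>x y. x \<in> S \<Longrightarrow> y \<in> S \<Longrightarrow> x \<noteq> y \<Longrightarrow> \<delta> \<le> \<bar>h x - h y\<bar>"
  shows "real (card S) \<le> 2 * r / \<delta> + 1"
proof -
  define \<phi> where "\<phi> x = \<lfloor>(h x + r) / \<delta>\<rfloor>" for x
  have "inj_on \<phi> S"
  proof (rule inj_onI, rule ccontr)
    fix x y assume xy: "x \<in> S" "y \<in> S" "\<phi> x = \<phi> y" "x \<noteq> y"
    have "\<bar>(h x + r) / \<delta> - (h y + r) / \<delta>\<bar> < 1" using xy(3) unfolding \<phi>_def by linarith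
    then have "\<bar>(h x - h y) / \<delta>\<bar> < 1" unfolding diff_divide_distrib[symmetric] by simp
    then have "\<bar>h x - h y\<bar> < \<delta>"
      unfolding abs_divide using \<open>\<delta> > 0\<close> by (simp add: pos_divide_less_eq)
    then show False using assms(5)[OF xy(1,2,4)] by simp
  qed
  moreover have "\<phi> ` S \<subseteq> {0..\<lfloor>2 * r / \<delta>\<rfloor>}"
  proof (rule image_subsetI)
    fix x assume "x \<in> S"
    then have "0 \<le> h x + r" "h x + r \<le> 2 * r" using assms(4)[of x] by linarith+
    then show "\<phi> x \<in> {0..\<lfloor>2 * r / \<delta>\<rfloor>}"
      using \<open>\<delta> > 0\<close> by (simp add: \<phi>_def floor_mono divide_right_mono)
  qed
  ultimately have "card S \<le> card {0..\<lfloor>2 * r / \<delta>\<rfloor>}"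
    by (intro card_inj_on_le) auto
  moreover have "0 \<le> 2 * r / \<delta>" using assms(2,3) by simp
  ultimately show ?thesis by (simp, linarith)
qed

lemma N_count_le:
  assumes "\<alpha> \<notin> \<rat>" "r \<ge> 0" "T < of_int (convergent_denom \<alpha> (Suc k))"
  shows "real (N_count \<alpha> r T) \<le> 4 * r / \<bar>convergent_diff \<alpha> k\<bar> + 2"
proof -
  let ?A = "approx_points \<alpha> r T"
  let ?d = "\<bar>convergent_diff \<alpha> k\<bar>"
  have bound: "real (card S) \<le> 2 * r / ?d + 1"
    if S: "S \<subseteq> ?A" and close: "\<And>p q p' q'. (p, q) \<in> S \<Longrightarrow> (p', q') \<in> S \<Longrightarrow> \<bar>real_of_int (q - q')\<bar> \<le> T" for S
  proof (rule card_separated_le[where h = "\<lambda>(p, q). \<alpha> * of_int q - of_int p"])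
    show "finite S" using S finite_approx_points finite_subset by blast
    show "?d > 0" using convergent_diff_nonzero[OF assms(1)] by simp
    show "\<bar>case x of (p, q) \<Rightarrow> \<alpha> * of_int q - of_int p\<bar> \<le> r" if "x \<in> S" for x
      using that S by (auto simp: approx_points_def)
    show "?d \<le> \<bar>(case x of (p, q) \<Rightarrow> \<alpha> * of_int q - of_int p) - (case y of (p, q) \<Rightarrow> \<alpha> * of_int q - of_int p)\<bar>"
      if xy: "x \<in> S" "y \<in> S" "x \<noteq> y" for x y
    proof -
      obtain p q p' q' where eq: "x = (p, q)" "y = (p', q')" by (cases x, cases y) auto
      have "\<bar>q - q'\<bar> < convergent_denom \<alpha> (Suc k)"
        using close[of p q p' q'] xy assms(3) unfolding eq by linarith
      then have "?d \<le> \<bar>\<alpha> * of_int (q - q') - of_int (p - p')\<bar>"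
        using xy(3) by (intro convergent_best_approximation[OF assms(1)]) (auto simp: eq)
      then show ?thesis by (simp add: eq algebra_simps)
    qed
  qed (use assms in auto)
  \<comment> \<open>Splitting by the sign of q keeps differences of q within T rather than 2T, hence
    below q_(k+1), where best approximation separates the errors. The two halves double the
    bound.\<close>
  let ?P = "{z \<in> ?A. snd z \<ge> 0}" and ?M = "{z \<in> ?A. snd z < 0}"
  have "card ?A = card (?P \<union> ?M)" by (intro arg_cong[where f = card]) auto
  also have "\<dots> \<le> card ?P + card ?M" by (rule card_Un_le)
  finally have "real (N_count \<alpha> r T) \<le> real (card ?P) + real (card ?M)" by (simp add: N_count_def)
  moreover have "real (card ?P) \<le> 2 * r / ?d + 1"
    by (rule bound) (auto simp: approx_points_def)
  moreover have "real (card ?M) \<le> 2 * r / ?d + 1"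
    by (rule bound) (auto simp: approx_points_def)
  ultimately show ?thesis by simp
qed

text \<open>The 6 is 4 + 2: multiplying the count 4r/D_k + 2 by min(r, D_k) gives at most 4r +
  2r.\<close>

lemma M_ratio_ge:
  assumes "\<alpha> \<notin> \<rat>" "r > 0" "T > 0" "T < of_int (convergent_denom \<alpha> (Suc k))"
  shows "T * min r \<bar>convergent_diff \<alpha> k\<bar> / 6 \<le> M_ratio \<alpha> r T"
proof -
  let ?d = "\<bar>convergent_diff \<alpha> k\<bar>" and ?N = "real (N_count \<alpha> r T)"
  have d: "?d > 0" using convergent_diff_nonzero[OF assms(1)] by simp
  have N: "?N > 0" using N_count_pos assms by simp
  have "min r ?d * ?N \<le> min r ?d * (4 * r / ?d + 2)"
    using N_count_le[OF assms(1) _ assms(4)] d assms(2) by (intro mult_left_mono) auto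
  also have "\<dots> = 4 * r * (min r ?d / ?d) + 2 * min r ?d" by (simp add: algebra_simps)
  also have "\<dots> \<le> 4 * r * 1 + 2 * r" using d assms(2) by (intro add_mono mult_left_mono) auto
  finally have "T * (min r ?d * ?N) \<le> T * (6 * r)" using assms(3) by (intro mult_left_mono) auto
  then show ?thesis using N by (simp add: M_ratio_def field_simps)
qed

lemma N_count_ge:
  assumes "\<alpha> \<notin> \<rat>" "r \<ge> 0" "T \<ge> 0"
  shows "min (T / of_int (convergent_denom \<alpha> k)) (r / \<bar>convergent_diff \<alpha> k\<bar>) \<le> real (N_count \<alpha> r T)"
    (is "?x \<le> _")
proof -
  let ?d = "\<bar>convergent_diff \<alpha> k\<bar>" and ?q = "convergent_denom \<alpha> k"
  have d: "?d > 0" using convergent_diff_nonzero[OF assms(1)] by simp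
  have q: "?q > 0" using convergent_denom_pos[OF assms(1)] .
  define g where "g m = (m * convergent_num \<alpha> k, m * ?q)" for m
  have "inj_on g {0..\<lfloor>?x\<rfloor>}" using q by (auto simp: inj_on_def g_def)
  moreover have "g ` {0..\<lfloor>?x\<rfloor>} \<subseteq> approx_points \<alpha> r T"
  proof (rule image_subsetI)
    fix m assume "m \<in> {0..\<lfloor>?x\<rfloor>}"
    then have m: "0 \<le> m" "of_int m \<le> T / of_int ?q" "of_int m \<le> r / ?d" by (auto simp: le_floor_iff)
    have "\<alpha> * of_int (m * ?q) - of_int (m * convergent_num \<alpha> k) = of_int m * convergent_diff \<alpha> k"
      by (simp add: convergent_diff_def algebra_simps)
    moreover have "\<bar>of_int m * convergent_diff \<alpha> k\<bar> \<le> r"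
      using m d by (simp add: abs_mult pos_le_divide_eq)
    ultimately show "g m \<in> approx_points \<alpha> r T"
      using m q by (simp add: approx_points_def g_def pos_le_divide_eq abs_mult)
  qed
  ultimately have "card {0..\<lfloor>?x\<rfloor>} \<le> N_count \<alpha> r T"
    unfolding N_count_def by (rule card_inj_on_le[OF _ _ finite_approx_points])
  \<comment> \<open>Including the multiple m = 0 gives floor(x) + 1 points, enough to exceed
    x.\<close>
  moreover have "0 \<le> ?x" using assms(2,3) d q by simp
  ultimately show ?thesis by (simp, linarith)
qed

text \<open>If r < D_k, the trivial N >= 1 suffices. Otherwise N is at least T/q_k or r/D_k, and
  these yield M <= r q_k and M <= T D_k respectively.\<close>

lemma M_ratio_le:
  assumes "\<alpha> \<notin> \<rat>" "r > 0" "T > 0"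
  shows "M_ratio \<alpha> r T \<le> T * min r \<bar>convergent_diff \<alpha> k\<bar> + r * of_int (convergent_denom \<alpha> k)"
proof -
  let ?d = "\<bar>convergent_diff \<alpha> k\<bar>" and ?N = "real (N_count \<alpha> r T)"
  let ?q = "real_of_int (convergent_denom \<alpha> k)"
  have d: "?d > 0" using convergent_diff_nonzero[OF assms(1)] by simp
  have q: "?q > 0" using convergent_denom_pos[OF assms(1)] by simp
  have "N_count \<alpha> r T > 0" using N_count_pos assms by simp
  then have N: "?N \<ge> 1" by linarith
  have "r * T \<le> (T * min r ?d + r * ?q) * ?N"
  proof (cases "r < ?d")
    case True
    have "r * T * 1 \<le> (r * T + r * ?q) * ?N"
      using N q assms by (intro mult_mono) auto
    then show ?thesis using True by (simp add: mult.commute)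
  next
    case False
    from N_count_ge[OF assms(1), of r T k] assms
    consider "T / ?q \<le> ?N" | "r / ?d \<le> ?N" by (auto simp: min_le_iff_disj)
    then show ?thesis
    proof cases
      case 1
      then have "T \<le> ?q * ?N" using q by (simp add: pos_divide_le_eq mult.commute)
      then have "r * T \<le> r * (?q * ?N)" using assms by (intro mult_left_mono) auto
      moreover have "0 \<le> T * min r ?d * ?N" using assms by auto
      ultimately show ?thesis by (simp add: algebra_simps)
    next
      case 2
      then have "r \<le> ?d * ?N" using d by (simp add: pos_divide_le_eq mult.commute)
      then have "T * r \<le> T * (?d * ?N)" using assms by (intro mult_left_mono) auto
      moreover have "0 \<le> r * ?q * ?N" using assms q by auto
      moreover have "min r ?d = ?d" using False by simp
      ultimately show ?thesis by (simp add: algebra_simps)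
    qed
  qed
  then show ?thesis using N by (simp add: M_ratio_def pos_divide_le_eq)
qed

section \<open>The convergent belonging to a given scale\<close>

text \<open>If q_0 = q_1 = 1, then n = 1 gets index 1, so no positive n is assigned to the empty
  block. At n = 0 the value is 0 although q_0 = 1 > n.\<close>

definition convergent_index :: "real \<Rightarrow> nat \<Rightarrow> nat" where
  "convergent_index \<alpha> n = (LEAST k. int n < convergent_denom \<alpha> (Suc k))"

lemma less_convergent_denom_index:
  assumes "\<alpha> \<notin> \<rat>"
  shows "int n < convergent_denom \<alpha> (Suc (convergent_index \<alpha> n))"
proof -
  have "int n < convergent_denom \<alpha> (Suc n)" using convergent_denom_ge[OF assms, of "Suc n"] by simp
  then show ?thesis unfolding convergent_index_def by (rule LeastI)
qed

lemma convergent_denom_index_le: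
  assumes "n > 0"
  shows "convergent_denom \<alpha> (convergent_index \<alpha> n) \<le> int n"
proof (cases "convergent_index \<alpha> n")
  case 0
  then show ?thesis using assms by simp
next
  case (Suc k)
  then show ?thesis
    using not_less_Least[of k "\<lambda>k. int n < convergent_denom \<alpha> (Suc k)"]
    unfolding convergent_index_def by auto
qed

lemma mono_convergent_index:
  assumes "\<alpha> \<notin> \<rat>"
  shows "mono (convergent_index \<alpha>)"
proof (rule monoI)
  fix m n :: nat assume "m \<le> n"
  then have "int m < convergent_denom \<alpha> (Suc (convergent_index \<alpha> n))"
    using less_convergent_denom_index[OF assms, of n] by simp
  then show "convergent_index \<alpha> m \<le> convergent_index \<alpha> n"
    unfolding convergent_index_def[of \<alpha> m] by (rule Least_le)
qed

lemma convergent_index_eq: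
  assumes "\<alpha> \<notin> \<rat>" "convergent_denom \<alpha> k \<le> int n" "int n < convergent_denom \<alpha> (Suc k)"
  shows "convergent_index \<alpha> n = k"
  unfolding convergent_index_def
proof (rule Least_equality)
  show "int n < convergent_denom \<alpha> (Suc k)" by fact
  fix l assume "int n < convergent_denom \<alpha> (Suc l)"
  then have "convergent_denom \<alpha> k < convergent_denom \<alpha> (Suc l)" using assms(2) by simp
  then have "k < Suc l" using mono_convergent_denom[OF assms(1)] by (metis monoD not_le)
  then show "k \<le> l" by simp
qed

section \<open>Two summability criteria for nonnegative series\<close>

text \<open>Partial sums over blocks are sums over [Q 0, Q n), and Q n >= n exhausts all indices;
  the finitely many terms before Q 0 only shift the bound. Empty blocks are allowed.\<close>

lemma summable_blocks_iff:
  fixes f :: "nat \<Rightarrow> real"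
  assumes "\<And>n. f n \<ge> 0" "mono Q" "\<And>k. k \<le> Q k"
  shows "summable (\<lambda>k. sum f {Q k..<Q (Suc k)}) \<longleftrightarrow> summable f"
proof
  have partial: "(\<Sum>k<n. sum f {Q k..<Q (Suc k)}) = sum f {Q 0..<Q n}" for n
  proof (induction n)
    case (Suc n)
    then show ?case
      using monoD[OF assms(2), of 0 n] monoD[OF assms(2), of n "Suc n"]
      by (simp add: sum.atLeastLessThan_concat)
  qed simp
  {
    assume s: "summable f"
    show "summable (\<lambda>k. sum f {Q k..<Q (Suc k)})"
    proof (rule bounded_imp_summable)
      fix n
      have "(\<Sum>k\<le>n. sum f {Q k..<Q (Suc k)}) = sum f {Q 0..<Q (Suc n)}"
        unfolding lessThan_Suc_atMost[symmetric] by (rule partial)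
      also have "\<dots> \<le> suminf f" using assms(1) s by (intro sum_le_suminf) auto
      finally show "(\<Sum>k\<le>n. sum f {Q k..<Q (Suc k)}) \<le> suminf f" .
    qed (use assms in \<open>auto intro: sum_nonneg\<close>)
  next
    let ?b = "\<lambda>k. sum f {Q k..<Q (Suc k)}"
    assume s: "summable ?b"
    show "summable f"
    proof (rule bounded_imp_summable)
      fix n
      have "sum f {..n} \<le> sum f ({..<Q 0} \<union> {Q 0..<Q (Suc n)})"
        using assms(1,3)[of "Suc n"] assms(1) by (intro sum_mono2) auto
      also have "\<dots> = sum f {..<Q 0} + (\<Sum>k<Suc n. ?b k)"
        unfolding partial by (intro sum.union_disjoint) auto
      also have "(\<Sum>k<Suc n. ?b k) \<le> suminf ?b"
        using assms(1) s by (intro sum_le_suminf) (auto intro: sum_nonneg)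
      finally show "sum f {..n} \<le> sum f {..<Q 0} + suminf ?b" by simp
    qed (use assms in auto)
  }
qed

lemma summable_affine_recurrence:
  fixes e g :: "nat \<Rightarrow> real"
  assumes "summable g" "\<And>n. e n \<ge> 0" "\<And>n. g n \<ge> 0" "\<rho> < 1"
    and "\<forall>\<^sub>F n in sequentially. e (Suc n) \<le> \<rho> * e n + g n"
  shows "summable e"
proof -
  obtain N where N: "\<And>n. n \<ge> N \<Longrightarrow> e (Suc n) \<le> \<rho> * e n + g n"
    using assms(5) by (auto simp: eventually_sequentially)
  let ?e = "\<lambda>n. e (n + N)" and ?g = "\<lambda>n. g (n + N)"
  have sg: "summable ?g" using assms(1) by (simp add: summable_iff_shift)
  have "summable ?e"
  proof (rule bounded_imp_summable)
    fix n
    have step: "?e (Suc m) \<le> \<rho> * ?e m + ?g m" for m using N[of "m + N"] by simp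
    \<comment> \<open>Summing the recurrence gives this; keeping the term
      \<open>- ?e (Suc n)\<close> makes the induction close.\<close>
    have "(1 - \<rho>) * (\<Sum>m\<le>n. ?e m) \<le> ?e 0 + sum ?g {..n} - ?e (Suc n)"
    proof (induction n)
      case 0
      then show ?case using step[of 0] by (simp add: algebra_simps)
    next
      case (Suc n)
      then show ?case using step[of "Suc n"] by (simp add: algebra_simps)
    qed
    also have "\<dots> \<le> ?e 0 + suminf ?g"
      using sum_le_suminf[OF sg, of "{..n}"] assms(2)[of "Suc n + N"] assms(3) by simp
    finally show "(\<Sum>m\<le>n. ?e m) \<le> (?e 0 + suminf ?g) / (1 - \<rho>)"
      using assms(4) by (simp add: field_simps)
  qed (use assms in auto)
  then show ?thesis by (simp add: summable_iff_shift)
qed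

section \<open>Comparison of the two series\<close>

theorem proposition4p1:
  fixes \<alpha> :: real and \<psi> :: "real \<Rightarrow> real"
  assumes "\<alpha> \<notin> \<rat>"
    and "\<And>x. x > 0 \<Longrightarrow> \<psi> x > 0"
    and "antimono_on {0<..} \<psi>"
    and "dyadically_regular \<psi>"
  shows "summable (\<lambda>j::nat. M_ratio \<alpha> (\<psi> (2 ^ j)) (2 ^ j)) \<longleftrightarrow>
    summable (\<lambda>k::nat.
      \<Sum>q = convergent_denom \<alpha> k..convergent_denom \<alpha> (k + 1) - 1.
        min (\<psi> (of_int q)) (dist_int (of_int (convergent_denom \<alpha> k) * \<alpha>)))"
    (is "summable ?M \<longleftrightarrow> summable ?B")
proof -
  note irr = assms(1) and pos = assms(2)
  have anti: "\<psi> y \<le> \<psi> x" if "0 < x" "x \<le> y" for x y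
    using assms(3) that by (auto simp: monotone_on_def)
  define D where "D k = \<bar>convergent_diff \<alpha> k\<bar>" for k
  define \<kappa> where "\<kappa> = convergent_index \<alpha>"
  define Q where "Q k = nat (convergent_denom \<alpha> k)" for k
  \<comment> \<open>The blocks start at q_0 = 1, so f 0 is free; 0 keeps f nonnegative, since psi is
    unconstrained at 0. Condensation asks for monotonicity only from 1 on.\<close>
  define f where "f n = (if n = 0 then 0 else min (\<psi> (real n)) (D (\<kappa> n)))" for n
  define g where "g j = 2 ^ j * f (2 ^ j)" for j
  define e where "e j = \<psi> (2 ^ j) * of_int (convergent_denom \<alpha> (\<kappa> (2 ^ j)))" for j
  have D_anti: "D l \<le> D k" if "k \<le> l" for k l
    using antimonoD[OF antimono_abs_convergent_diff[OF irr] that] by (simp add: D_def)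
  have Dpos: "D k > 0" for k using convergent_diff_nonzero[OF irr] by (simp add: D_def)
  have f_nonneg: "f n \<ge> 0" for n using pos[of "real n"] Dpos[of "\<kappa> n"] by (auto simp: f_def)
  have g_eq: "g j = 2 ^ j * min (\<psi> (2 ^ j)) (D (\<kappa> (2 ^ j)))" for j by (simp add: g_def f_def)
  have g_nonneg: "g j \<ge> 0" for j using f_nonneg by (simp add: g_def)
  have e_nonneg: "e j \<ge> 0" for j
    using pos[of "2 ^ j"] convergent_denom_pos[OF irr, of "\<kappa> (2 ^ j)"] by (simp add: e_def)

  have "?B k = sum f {Q k..<Q (Suc k)}" for k
  proof -
    let ?q = "convergent_denom \<alpha>"
    have qk: "?q k > 0" "?q (Suc k) > 0" using convergent_denom_pos[OF irr] by auto
    have "?B k = (\<Sum>n = Q k..<Q (Suc k). min (\<psi> (real n)) (dist_int (of_int (?q k) * \<alpha>)))"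
      using qk by (intro sum.reindex_bij_witness[of _ int nat]) (auto simp: Q_def)
    also have "\<dots> = sum f {Q k..<Q (Suc k)}"
    proof (rule sum.cong)
      \<comment> \<open>A member n of the block witnesses q_k < q_(k+1), as the distance formula
        requires; an empty block contributes 0 on both sides.\<close>
      fix n assume "n \<in> {Q k..<Q (Suc k)}"
      then have n: "?q k \<le> int n" "int n < ?q (Suc k)" using qk by (auto simp: Q_def)
      then have "\<kappa> n = k" unfolding \<kappa>_def by (rule convergent_index_eq[OF irr])
      moreover have "dist_int (of_int (?q k) * \<alpha>) = D k"
        unfolding D_def using n by (intro dist_int_convergent[OF irr]) simp
      ultimately show "min (\<psi> (real n)) (dist_int (of_int (?q k) * \<alpha>)) = f n"
        using n qk by (auto simp: f_def)
    qed simp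
    finally show ?thesis .
  qed
  then have "summable ?B \<longleftrightarrow> summable (\<lambda>k. sum f {Q k..<Q (Suc k)})" by simp
  also have "\<dots> \<longleftrightarrow> summable f"
  proof (rule summable_blocks_iff)
    show "mono Q" using mono_convergent_denom[OF irr] by (auto simp: Q_def mono_def intro!: nat_mono)
    show "k \<le> Q k" for k using convergent_denom_ge[OF irr, of k] by (simp add: Q_def)
  qed (rule f_nonneg)
  also have "\<dots> \<longleftrightarrow> summable g"
    unfolding g_def
  proof (rule condensation_test)
    fix m :: nat assume "0 < m"
    have "\<kappa> m \<le> \<kappa> (Suc m)"
      unfolding \<kappa>_def by (rule monoD[OF mono_convergent_index[OF irr]]) simp
    then have "D (\<kappa> (Suc m)) \<le> D (\<kappa> m)" by (rule D_anti)
    moreover have "\<psi> (real (Suc m)) \<le> \<psi> (real m)" using \<open>0 < m\<close> by (intro anti) auto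
    ultimately show "f (Suc m) \<le> f m" using \<open>0 < m\<close> by (auto simp: f_def)
  qed (rule f_nonneg)
  finally have B_iff: "summable ?B \<longleftrightarrow> summable g" .

  have lower: "g j / 6 \<le> ?M j" for j
    unfolding g_eq D_def
  proof (rule M_ratio_ge[OF irr])
    show "(2 :: real) ^ j < of_int (convergent_denom \<alpha> (Suc (\<kappa> (2 ^ j))))"
      using less_convergent_denom_index[OF irr, of "2 ^ j"] unfolding \<kappa>_def
      by (metis of_int_less_iff of_int_of_nat_eq of_nat_numeral of_nat_power)
  qed (use pos in auto)
  have upper: "?M j \<le> g j + e j" for j
    unfolding g_eq D_def e_def using pos[of "2 ^ j"] by (intro M_ratio_le[OF irr]) auto
  have M_nonneg: "?M j \<ge> 0" for j using lower[of j] g_nonneg[of j] by linarith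

  have e: "summable e" if sg: "summable g"
  proof -
    obtain \<rho> k0 where \<rho>: "0 < \<rho>" "\<rho> < 1" "\<And>k. k \<ge> k0 \<Longrightarrow> \<psi> (2 ^ (k + 1)) \<le> \<rho> * \<psi> (2 ^ k)"
      using assms(4) unfolding dyadically_regular_def by blast
    have "\<forall>\<^sub>F j in sequentially. g j < 1 / 4"
      using summable_LIMSEQ_zero[OF sg] by (rule order_tendstoD) simp
    moreover have "\<forall>\<^sub>F j in sequentially. j \<ge> k0" by (rule eventually_ge_at_top)
    ultimately have "\<forall>\<^sub>F j in sequentially. e (Suc j) \<le> \<rho> * e j + 2 * g j"
    proof eventually_elim
      case (elim j)
      let ?q = "\<lambda>k. real_of_int (convergent_denom \<alpha> k)"
      show ?case
      proof (cases "\<kappa> (2 ^ Suc j) = \<kappa> (2 ^ j)")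
        case True
        have "\<psi> (2 ^ Suc j) * ?q (\<kappa> (2 ^ j)) \<le> \<rho> * \<psi> (2 ^ j) * ?q (\<kappa> (2 ^ j))"
          using \<rho>(3)[OF elim(2)] convergent_denom_pos[OF irr, of "\<kappa> (2 ^ j)"]
          by (intro mult_right_mono) auto
        then show ?thesis using True g_nonneg[of j] by (simp add: e_def)
      next
        case False
        let ?k = "\<kappa> (2 ^ j)" and ?l = "\<kappa> (2 ^ Suc j)"
        have "?k \<le> ?l"
          unfolding \<kappa>_def by (rule monoD[OF mono_convergent_index[OF irr]]) simp
        then have "Suc ?k \<le> ?l" using False by simp
        then have "convergent_denom \<alpha> (Suc ?k) \<le> convergent_denom \<alpha> ?l"
          by (rule monoD[OF mono_convergent_denom[OF irr]])
        moreover have "convergent_denom \<alpha> ?l \<le> int (2 ^ Suc j)"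
          unfolding \<kappa>_def by (rule convergent_denom_index_le) simp
        \<comment> \<open>Several convergents may be skipped, so \<open>?l\<close> can exceed
          \<open>Suc ?k\<close>. The bound at \<open>Suc ?k\<close> controls D_k from below, the one
          at \<open>?l\<close> controls e_(j+1) from above.\<close>
        ultimately have "?q (Suc ?k) \<le> of_int (int (2 ^ Suc j))" "?q ?l \<le> of_int (int (2 ^ Suc j))"
          by linarith+
        then have q: "?q (Suc ?k) \<le> 2 ^ Suc j" "?q ?l \<le> 2 ^ Suc j" by simp_all
        have "1 / (2 * 2 ^ Suc j) \<le> 1 / (2 * ?q (Suc ?k))"
          using q convergent_denom_pos[OF irr, of "Suc ?k"] by (intro divide_left_mono) auto
        also have "\<dots> \<le> D ?k" unfolding D_def by (rule abs_convergent_diff_ge[OF irr])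
        finally have "1 / 4 \<le> 2 ^ j * D ?k" by (simp add: field_simps)
        then have g: "g j = 2 ^ j * \<psi> (2 ^ j)"
          using elim(1) unfolding g_eq by (auto simp: min_def split: if_splits)
        \<comment> \<open>Monotonicity of psi is enough in this case; the factor 2 in the recurrence
          comes from q_l <= 2^(j+1).\<close>
        have "\<psi> (2 ^ Suc j) * ?q ?l \<le> \<psi> (2 ^ j) * 2 ^ Suc j"
          using q pos[of "2 ^ j"] convergent_denom_pos[OF irr, of ?l]
          by (intro mult_mono anti) auto
        moreover have "\<psi> (2 ^ j) * 2 ^ Suc j = 2 * g j" unfolding g by simp
        ultimately have "e (Suc j) \<le> 2 * g j" by (simp only: e_def)
        moreover have "0 \<le> \<rho> * e j" using \<rho>(1) e_nonneg by simp
        ultimately show ?thesis by linarith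
      qed
    qed
    then show ?thesis
      using sg \<rho>(2) e_nonneg g_nonneg
      by (intro summable_affine_recurrence[of "\<lambda>j. 2 * g j" e \<rho>]) (auto intro: summable_mult)
  qed
  have "summable ?M" if "summable g"
  proof (rule summable_comparison_test')
    show "summable (\<lambda>j. g j + e j)" using that e by (intro summable_add)
    show "norm (?M j) \<le> g j + e j" for j using upper[of j] M_nonneg[of j] by simp
  qed
  moreover have "summable g" if "summable ?M"
  proof -
    have "summable (\<lambda>j. g j / 6)"
    proof (rule summable_comparison_test')
      show "norm (g j / 6) \<le> ?M j" for j using lower[of j] g_nonneg[of j] by simp
    qed (rule that)
    then show ?thesis using summable_divide_iff[of g 6] by simp
  qed
  ultimately show ?thesis using B_iff by blast
qed

end
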